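(* For every $\delta\in(0,1)$ we have $$\frac{1}{\log\frac{1}{\delta}}\leq\liminf_{N\to\infty}\frac{\phi_\delta(N)}{\log N}.$$
   Context: $\mathbb{N}=\{1,2,\ldots\}$, $[N]=\{1,\ldots,N\}$, and $\log$ is the natural logarithm. $B+C=\{b+c: b\in B,\ c\in C\}$. For $\delta\in(0,1)$ and $N\in\mathbb{N}$, $\phi_\delta(N)$ is the largest integer such that any set $A\subseteq[N]$ with $|A|\geq\delta N$ contains a set of the form $B+C$ where $B,C\subseteq[N]$ satisfy $\min\{|B|,|C|\}\geq\phi_\delta(N)$. *)

theory Defs
  imports Complex_Main "HOL-Library.Set_Algebras" "HOL-Library.Liminf_Limsup" "HOL-Library.Extended_Real"
begin

definition sumset_prop :: "real \<Rightarrow> nat \<Rightarrow> nat \<Rightarrow> bool" where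
  "sumset_prop \<delta> N m \<longleftrightarrow>
     (\<forall>A. A \<subseteq> {1..N} \<and> real (card A) \<ge> \<delta> * real N \<longrightarrow>
        (\<exists>B C. B \<subseteq> {1..N} \<and> C \<subseteq> {1..N} \<and> B + C \<subseteq> A \<and> min (card B) (card C) \<ge> m))"

definition phi :: "real \<Rightarrow> nat \<Rightarrow> nat" where
  "phi \<delta> N = (GREATEST m. sumset_prop \<delta> N m)"

(* For \<delta> \<le> 1 the greatest element in the definition of phi really exists:
   m = 0 is witnessed by empty B and C, and A = {1..N} forces m \<le> N. *)

lemma sumset_prop_0: "sumset_prop \<delta> N 0"
  unfolding sumset_prop_def by (auto intro!: exI[of _ "{}"] simp: set_plus_def)

lemma sumset_prop_le:
  assumes "\<delta> \<le> 1" "sumset_prop \<delta> N m"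
  shows "m \<le> N"
proof -
  have "real (card {1..N}) \<ge> \<delta> * real N"
    using assms(1) mult_right_mono[of \<delta> 1 "real N"] by simp
  then obtain B :: "nat set" where "B \<subseteq> {1..N}" "card B \<ge> m"
    using assms(2) unfolding sumset_prop_def by (metis min.bounded_iff order_refl)
  then show ?thesis
    using card_mono[of "{1..N}" B] by simp
qed

lemma sumset_prop_phi: "\<delta> \<le> 1 \<Longrightarrow> sumset_prop \<delta> N (phi \<delta> N)"
  unfolding phi_def using GreatestI_nat[of "sumset_prop \<delta> N" 0 N] sumset_prop_0 sumset_prop_le
  by blast

lemma phi_greatest: "\<delta> \<le> 1 \<Longrightarrow> sumset_prop \<delta> N m \<Longrightarrow> m \<le> phi \<delta> N"
  unfolding phi_def using Greatest_le_nat[of "sumset_prop \<delta> N" m N] sumset_prop_le by blast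

end

theory Submission
  imports Defs "HOL-Real_Asymp.Real_Asymp"
begin

text \<open>A Kovari--Sos--Turan argument on the bipartite graph joining $x \le M$ to $y \le N$ when
$x + y \in A$, where $M \approx \sqrt N$.  As $M = o(N)$, the graph has density at least
$\delta - o(1)$, so a positive proportion of the $y$ have at least $\delta_1 M$ neighbours for any fixed
$\delta_1 < \delta$.  As $t = c \log N = o(M)$, each such $y$ is joined to all of
a $\delta_2^t$-proportion of the $t$-subsets of $[M]$, for any fixed $\delta_2 < \delta_1$.
Hence some $t$-subset has $\gg N \delta_2^t$ common neighbours, which exceeds $t$ if
$c \log (1/\delta_2) < 1$.\<close>

lemma sum_card_swap:
  assumes "finite X" "finite Y"
  shows "(\<Sum>x\<in>X. card {y\<in>Y. R x y}) = (\<Sum>y\<in>Y. card {x\<in>X. R x y})"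
  using sum.swap_restrict[OF assms, of "\<lambda>_ _. 1::nat" R] by simp

text \<open>Double counting of pairs (\<open>S\<close>, \<open>y\<close>) with \<open>S\<close> a
  \<open>t\<close>-subset of \<open>D y\<close>: each \<open>y\<close> lies in at least
  \<open>k choose t\<close> pairs, so by \<open>gt\<close> the average over the
  \<open>card X choose t\<close> possible \<open>S\<close> exceeds \<open>s\<close>.\<close>

lemma common_neighbours:
  fixes D :: "'b \<Rightarrow> 'a set"
  assumes "finite X" "finite G"
    and D: "\<And>y. y \<in> G \<Longrightarrow> D y \<subseteq> X \<and> k \<le> card (D y)"
    and gt: "s * (card X choose t) < card G * (k choose t)"
  obtains S where "S \<subseteq> X" "card S = t" "s < card {y\<in>G. S \<subseteq> D y}"
proof -
  let ?T = "{S. S \<subseteq> X \<and> card S = t}"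
  have fT: "finite ?T" using assms(1) by simp
  have "card G * (k choose t) = (\<Sum>y\<in>G. k choose t)" by simp
  also have "\<dots> \<le> (\<Sum>y\<in>G. card {S\<in>?T. S \<subseteq> D y})"
  proof (rule sum_mono)
    fix y assume "y \<in> G"
    then have "D y \<subseteq> X" "k \<le> card (D y)" using D by auto
    then have "{S\<in>?T. S \<subseteq> D y} = {S. S \<subseteq> D y \<and> card S = t}" by auto
    moreover have "finite (D y)" using \<open>D y \<subseteq> X\<close> assms(1) finite_subset by blast
    ultimately show "k choose t \<le> card {S\<in>?T. S \<subseteq> D y}"
      using \<open>k \<le> card (D y)\<close> by (simp add: n_subsets binomial_right_mono)
  qed
  also have "\<dots> = (\<Sum>S\<in>?T. card {y\<in>G. S \<subseteq> D y})"
    by (rule sum_card_swap[OF assms(2) fT])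
  finally have "(\<Sum>S\<in>?T. s) < (\<Sum>S\<in>?T. card {y\<in>G. S \<subseteq> D y})"
    using gt assms(1) by (simp add: n_subsets mult.commute)
  then obtain S where "S \<in> ?T" "s < card {y\<in>G. S \<subseteq> D y}"
    by (meson not_le sum_mono)
  then show thesis using that by blast
qed

text \<open>Each factor \<open>k - i\<close> of the falling factorial of \<open>k\<close> is at
  least \<open>k - t\<close>, hence at least \<open>a * m\<close>, while the falling factorial of
  \<open>m\<close> is at most \<open>m ^ t\<close>.\<close>

lemma binomial_ratio_ge:
  assumes "0 \<le> a" "a * real m + real t \<le> real k"
  shows "a ^ t * real (m choose t) \<le> real (k choose t)"
proof -
  have "(a * real m) ^ t = (\<Prod>i = 0..<t. a * real m)" by simp
  also have "\<dots> \<le> (\<Prod>i = 0..<t. real k - real i)"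
    using assms by (intro prod_mono) auto
  also have "\<dots> = fact t * real (k choose t)"
    by (simp add: gbinomial_mult_fact binomial_gbinomial)
  finally have lower: "(a * real m) ^ t \<le> fact t * real (k choose t)" .
  have "fact t * (m choose t) \<le> m ^ t"
    using binomial_fact_pow[of m t] by (simp add: mult.commute)
  then have "real (fact t * (m choose t)) \<le> real (m ^ t)"
    by (simp only: of_nat_le_iff)
  then have "a ^ t * (fact t * real (m choose t)) \<le> a ^ t * real m ^ t"
    using assms(1) by (intro mult_left_mono) auto
  also have "\<dots> \<le> fact t * real (k choose t)"
    using lower by (simp add: power_mult_distrib)
  finally have "fact t * (a ^ t * real (m choose t)) \<le> fact t * real (k choose t)"
    by (simp add: mult.left_commute)
  then show ?thesis by simp
qed

text \<open>Translating \<open>A\<close> down by \<open>x\<close> loses only its elements in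
  \<open>{1..x}\<close>.\<close>

lemma card_shift_ge:
  fixes A :: "nat set"
  assumes "A \<subseteq> {1..N}"
  shows "card A \<le> card {y\<in>{1..N}. x + y \<in> A} + x"
proof -
  let ?Y = "{y\<in>{1..N}. x + y \<in> A}"
  have "A \<subseteq> (+) x ` ?Y \<union> {1..x}"
  proof
    fix a assume "a \<in> A"
    show "a \<in> (+) x ` ?Y \<union> {1..x}"
    proof (cases "a \<le> x")
      case False
      then have "a = x + (a - x)" "a - x \<in> ?Y" using \<open>a \<in> A\<close> assms by auto
      then show ?thesis by blast
    qed (use \<open>a \<in> A\<close> assms in auto)
  qed
  then have "card A \<le> card ((+) x ` ?Y \<union> {1..x})" by (intro card_mono) auto
  also have "\<dots> \<le> card ?Y + x"
    using card_Un_le[of "(+) x ` ?Y" "{1..x}"] card_image_le[of ?Y "(+) x"] by simp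
  finally show ?thesis .
qed

text \<open>Edges \<open>x + y \<in> A\<close> are counted from both sides. Each
  \<open>x \<le> M\<close> has at least \<open>\<delta> * N - M\<close> neighbours by
  \<open>card_shift_ge\<close>, so few \<open>y\<close> of large degree would leave too few
  edges.\<close>

lemma many_large_degrees:
  fixes A :: "nat set"
  assumes "A \<subseteq> {1..N}" "\<delta> * real N \<le> real (card A)" "0 < M" "0 \<le> \<delta>\<^sub>1"
  defines "d \<equiv> \<lambda>y. card {x\<in>{1..M}. x + y \<in> A}"
  shows "(\<delta> - \<delta>\<^sub>1) * real N - real M \<le> real (card {y\<in>{1..N}. \<delta>\<^sub>1 * real M \<le> real (d y)})"
proof -
  let ?G = "{y\<in>{1..N}. \<delta>\<^sub>1 * real M \<le> real (d y)}"
  have "real M * (\<delta> * real N - real M) = (\<Sum>x\<in>{1..M}. \<delta> * real N - real M)" by simp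
  also have "\<dots> \<le> (\<Sum>x\<in>{1..M}. real (card {y\<in>{1..N}. x + y \<in> A}))"
  proof (rule sum_mono)
    fix x assume "x \<in> {1..M}"
    then show "\<delta> * real N - real M \<le> real (card {y\<in>{1..N}. x + y \<in> A})"
      using card_shift_ge[OF assms(1), of x] assms(2) by auto
  qed
  also have "\<dots> = real (\<Sum>y\<in>{1..N}. d y)"
    unfolding d_def of_nat_sum[symmetric]
    by (intro arg_cong[where f = real] sum_card_swap) simp_all
  also have "\<dots> = (\<Sum>y\<in>{1..N}. real (d y))" by simp
  \<comment> \<open>A degree is below \<open>\<delta>\<^sub>1 * M\<close> off \<open>?G\<close> and
    at most \<open>M\<close> on it; granting \<open>\<delta>\<^sub>1 * M\<close> to every
    \<open>y\<close> keeps the sum simple.\<close>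
  also have "\<dots> \<le> (\<Sum>y\<in>{1..N}. \<delta>\<^sub>1 * real M + (if y \<in> ?G then real M else 0))"
  proof (rule sum_mono)
    fix y assume "y \<in> {1..N}"
    have "d y \<le> card {1..M}" unfolding d_def by (intro card_mono) auto
    then show "real (d y) \<le> \<delta>\<^sub>1 * real M + (if y \<in> ?G then real M else 0)"
      using \<open>y \<in> {1..N}\<close> assms(4) by (auto intro: add_increasing)
  qed
  also have "\<dots> = real M * (\<delta>\<^sub>1 * real N + real (card ?G))"
    by (simp add: sum.distrib sum.If_cases Int_def algebra_simps)
  finally have "\<delta> * real N - real M \<le> \<delta>\<^sub>1 * real N + real (card ?G)"
    using assms(3) by simp
  then show ?thesis by (simp add: algebra_simps)
qed

text \<open>\<open>B\<close> is a \<open>t\<close>-subset of \<open>{1..M}\<close> and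
  \<open>C\<close> the set of its common neighbours among the \<open>y\<close> of large degree;
  \<open>N\<close> bounds the number of the latter from below so that
  \<open>common_neighbours\<close> applies with \<open>s = t\<close>.\<close>

lemma sumset_prop_if_large:
  assumes "0 < M" "M \<le> N" "0 \<le> \<delta>\<^sub>1" "0 < \<delta>\<^sub>2"
    and M: "real t \<le> (\<delta>\<^sub>1 - \<delta>\<^sub>2) * real M" "t \<le> M"
    and N: "real t < ((\<delta> - \<delta>\<^sub>1) * real N - real M) * \<delta>\<^sub>2 ^ t"
  shows "sumset_prop \<delta> N t"
  unfolding sumset_prop_def
proof (intro allI impI, elim conjE)
  fix A assume A: "A \<subseteq> {1..N}" "real (card A) \<ge> \<delta> * real N"
  define D where "D y = {x\<in>{1..M}. x + y \<in> A}" for y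
  define G where "G = {y\<in>{1..N}. \<delta>\<^sub>1 * real M \<le> real (card (D y))}"
  define k where "k = nat \<lceil>\<delta>\<^sub>1 * real M\<rceil>"
  have k: "\<delta>\<^sub>1 * real M \<le> real k" unfolding k_def by linarith
  have G: "(\<delta> - \<delta>\<^sub>1) * real N - real M \<le> real (card G)"
    unfolding G_def D_def by (rule many_large_degrees[OF A assms(1,3)])
  \<comment> \<open>The first part of \<open>M\<close> gives
    \<open>\<delta>\<^sub>2 * M + t \<le> \<delta>\<^sub>1 * M \<le> k\<close>.\<close>
  have ratio: "\<delta>\<^sub>2 ^ t * real (M choose t) \<le> real (k choose t)"
    using assms(4) M k by (intro binomial_ratio_ge) (auto simp: algebra_simps)
  \<comment> \<open>Strictness survives the multiplication because \<open>t \<le> M\<close> makes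
    \<open>M choose t\<close> positive.\<close>
  have "real t * real (M choose t) < real (card G) * \<delta>\<^sub>2 ^ t * real (M choose t)"
  proof (rule mult_strict_right_mono)
    show "real t < real (card G) * \<delta>\<^sub>2 ^ t"
      using mult_right_mono[OF G, of "\<delta>\<^sub>2 ^ t"] assms(4)
      by (intro less_le_trans[OF N]) simp
  qed (use M in simp)
  also have "\<dots> \<le> real (card G) * real (k choose t)"
    using mult_left_mono[OF ratio, of "real (card G)"] by (simp add: mult.assoc)
  finally have "t * (card {1..M} choose t) < card G * (k choose t)"
    by (simp flip: of_nat_mult)
  moreover have "D y \<subseteq> {1..M} \<and> k \<le> card (D y)" if "y \<in> G" for y
    using that unfolding G_def D_def k_def by (auto simp: nat_le_iff ceiling_le_iff)
  moreover have "finite G" unfolding G_def by simp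
  ultimately obtain S where S: "S \<subseteq> {1..M}" "card S = t" "t < card {y\<in>G. S \<subseteq> D y}"
    using common_neighbours[of "{1..M}" G D k t t] by blast
  show "\<exists>B C. B \<subseteq> {1..N} \<and> C \<subseteq> {1..N} \<and> B + C \<subseteq> A \<and> t \<le> min (card B) (card C)"
  proof (intro exI conjI)
    show "S \<subseteq> {1..N}" using S(1) assms(2) by auto
    show "{y\<in>G. S \<subseteq> D y} \<subseteq> {1..N}" unfolding G_def by auto
    show "S + {y\<in>G. S \<subseteq> D y} \<subseteq> A" unfolding D_def by (auto elim!: set_plus_elim)
  qed (use S in simp)
qed

lemma eventually_phi_ge:
  assumes "0 < \<delta>" "\<delta> < 1" "0 < c" "c < 1 / ln (1 / \<delta>)"
  shows "\<forall>\<^sub>F N in sequentially. c * ln (real N) \<le> real (phi \<delta> N)"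
proof -
  have "0 < ln (1 / \<delta>)" using assms by simp
  then have "- 1 / c < ln \<delta>"
    using assms by (simp add: field_simps ln_div)
  then have exp_gt: "exp (- 1 / c) < \<delta>"
    using assms(1) by (metis exp_less_cancel_iff exp_ln)
  \<comment> \<open>The condition \<open>c * ln (1 / \<delta>) < 1\<close> is open in \<delta>, so
    it still holds at some \<open>\<delta>\<^sub>2 < \<delta>\<close>, with room for
    \<open>\<delta>\<^sub>1\<close> in between.\<close>
  obtain \<delta>\<^sub>2 where \<delta>\<^sub>2: "exp (- 1 / c) < \<delta>\<^sub>2" "\<delta>\<^sub>2 < \<delta>" using dense[OF exp_gt] by blast
  obtain \<delta>\<^sub>1 where \<delta>\<^sub>1: "\<delta>\<^sub>2 < \<delta>\<^sub>1" "\<delta>\<^sub>1 < \<delta>" using dense[OF \<delta>\<^sub>2(2)] by blast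
  have pos: "0 < \<delta>\<^sub>2" using \<delta>\<^sub>2(1) less_trans[OF exp_gt_zero] by blast
  \<comment> \<open>With this exponent, \<open>\<delta>\<^sub>2\<close> to the power
    \<open>c * ln N\<close> equals \<open>N powr (- \<gamma>)\<close>; as \<gamma> < 1, multiplying
    by \<open>N\<close> leaves the positive power \<kappa> = 1 - \<gamma>, which beats the
    logarithm.\<close>
  define \<gamma> where "\<gamma> = - c * ln \<delta>\<^sub>2"
  have "- 1 / c < ln \<delta>\<^sub>2" using \<delta>\<^sub>2(1) pos by (metis exp_less_cancel_iff exp_ln)
  then have \<gamma>: "\<gamma> < 1" unfolding \<gamma>_def using assms(3) by (simp add: field_simps)
  define \<epsilon> where "\<epsilon> = \<delta>\<^sub>1 - \<delta>\<^sub>2"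
  define \<eta> where "\<eta> = \<delta> - \<delta>\<^sub>1"
  have \<epsilon>\<eta>: "0 < \<epsilon>" "0 < \<eta>" using \<delta>\<^sub>1 by (auto simp: \<epsilon>_def \<eta>_def)
  define \<kappa> where "\<kappa> = 1 - \<gamma>"
  have \<kappa>: "0 < \<kappa>" using \<gamma> by (simp add: \<kappa>_def)
  \<comment> \<open>The three estimates will give \<open>M \<le> \<eta> / 2 * N\<close>,
    \<open>t \<le> \<epsilon> * M\<close> and the final count. Each \<open>+ 1\<close> pays for a
    ceiling in \<open>M\<close> or \<open>t\<close>.\<close>
  have ev1: "\<forall>\<^sub>F N in sequentially. sqrt (real N) + 1 \<le> \<eta> / 2 * real N"
    using \<epsilon>\<eta> by real_asymp
  have ev2: "\<forall>\<^sub>F N in sequentially. c * ln (real N) + 1 \<le> \<epsilon> * sqrt (real N)"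
    using \<epsilon>\<eta> assms(3) by real_asymp
  have ev3: "\<forall>\<^sub>F N in sequentially. c * ln (real N) + 1 < \<eta> / 2 * \<delta>\<^sub>2 * real N powr \<kappa>"
    using \<epsilon>\<eta> \<kappa> pos assms(3) by real_asymp
  show ?thesis using ev1 ev2 ev3 eventually_gt_at_top[of 0]
  proof eventually_elim
    case (elim N)
    define M where "M = nat \<lceil>sqrt (real N)\<rceil>"
    define t where "t = nat \<lceil>c * ln (real N)\<rceil>"
    have "0 \<le> c * ln (real N)" using elim(4) assms(3) by simp
    then have t: "c * ln (real N) \<le> real t" "real t \<le> c * ln (real N) + 1"
      unfolding t_def by linarith+
    have M: "sqrt (real N) \<le> real M" "real M \<le> sqrt (real N) + 1"
      unfolding M_def using real_sqrt_ge_zero[of "real N"] by linarith+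
    have tM: "real t \<le> \<epsilon> * real M"
      using t(2) elim(2) mult_left_mono[OF M(1), of \<epsilon>] \<epsilon>\<eta> by linarith
    have half: "\<eta> / 2 * real N \<le> \<eta> * real N - real M" using M(2) elim(1) by simp
    have "\<eta> / 2 * real N \<le> 1 * real N"
      using \<delta>\<^sub>1 \<delta>\<^sub>2 pos assms by (intro mult_right_mono) (auto simp: \<eta>_def)
    then have "M \<le> N" using M(2) elim(1) by linarith
    have "\<epsilon> * real M \<le> 1 * real M"
      using \<delta>\<^sub>1 \<delta>\<^sub>2 pos assms by (intro mult_right_mono) (auto simp: \<epsilon>_def)
    then have "t \<le> M" using tM by linarith
    \<comment> \<open>Since \<open>\<delta>\<^sub>2 < 1\<close>, rounding \<open>c * ln N\<close> up
      to \<open>t\<close> costs at most one factor \<open>\<delta>\<^sub>2\<close>, the one allowed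
      for in \<open>ev3\<close>.\<close>
    have "real N powr (- \<gamma>) * \<delta>\<^sub>2 = \<delta>\<^sub>2 powr (c * ln (real N) + 1)"
      using elim(4) pos by (simp add: powr_def \<gamma>_def exp_add distrib_left mult_ac)
    also have "\<dots> \<le> \<delta>\<^sub>2 powr real t"
      using t(2) pos \<delta>\<^sub>2 assms by (intro powr_mono') auto
    finally have pow: "real N powr (- \<gamma>) * \<delta>\<^sub>2 \<le> \<delta>\<^sub>2 ^ t"
      using pos by (simp add: powr_realpow)
    have "real t < \<eta> / 2 * \<delta>\<^sub>2 * real N powr \<kappa>" using t(2) elim(3) by simp
    also have "\<dots> = \<eta> / 2 * real N * (real N powr (- \<gamma>) * \<delta>\<^sub>2)"
      using elim(4) powr_add[of "real N" 1 "- \<gamma>"] by (simp add: \<kappa>_def)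
    also have "\<dots> \<le> (\<eta> * real N - real M) * \<delta>\<^sub>2 ^ t"
    proof (rule mult_mono[OF half pow])
      have "0 \<le> \<eta> / 2 * real N" using \<epsilon>\<eta> by simp
      then show "0 \<le> \<eta> * real N - real M" using half by linarith
    qed (use pos in simp)
    finally have "sumset_prop \<delta> N t"
      using \<open>M \<le> N\<close> \<open>t \<le> M\<close> tM \<delta>\<^sub>1 pos M(1) elim(4)
      by (intro sumset_prop_if_large[of M N \<delta>\<^sub>1 \<delta>\<^sub>2]) (auto simp: \<epsilon>_def \<eta>_def intro!: Nat.gr0I)
    then have "t \<le> phi \<delta> N" using assms(2) by (intro phi_greatest) auto
    then show ?case using t(1) by linarith
  qed
qed

theorem corollary3:
  fixes \<delta> :: real
  assumes "0 < \<delta>" and "\<delta> < 1"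
  shows "ereal (1 / ln (1 / \<delta>)) \<le> liminf (\<lambda>N. ereal (real (phi \<delta> N) / ln (real N)))"
proof (rule dense_le)
  fix y assume "y < ereal (1 / ln (1 / \<delta>))"
  moreover have "ereal 0 < ereal (1 / ln (1 / \<delta>))" using assms by simp
  \<comment> \<open>The maximum with 0 makes the intermediate \<open>z\<close> a positive real, as
    \<open>eventually_phi_ge\<close> requires of \<open>c\<close>.\<close>
  ultimately have "max y (ereal 0) < ereal (1 / ln (1 / \<delta>))" by simp
  then obtain z where z: "max y (ereal 0) < z" "z < ereal (1 / ln (1 / \<delta>))"
    using dense by blast
  then obtain c where c: "z = ereal c" by (cases z) auto
  have "0 < c" "c < 1 / ln (1 / \<delta>)" using z by (auto simp: c)
  then have "\<forall>\<^sub>F N in sequentially. c * ln (real N) \<le> real (phi \<delta> N)"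
    by (rule eventually_phi_ge[OF assms])
  \<comment> \<open>For \<open>N > 1\<close> the logarithm is positive, so dividing by it is
    sound.\<close>
  then have "\<forall>\<^sub>F N in sequentially. ereal c \<le> ereal (real (phi \<delta> N) / ln (real N))"
    using eventually_gt_at_top[of 1] by eventually_elim (simp add: pos_le_divide_eq)
  then have "ereal c \<le> liminf (\<lambda>N. ereal (real (phi \<delta> N) / ln (real N)))"
    by (rule Liminf_bounded)
  moreover have "y \<le> ereal c" using z(1) by (simp add: c less_imp_le)
  ultimately show "y \<le> liminf (\<lambda>N. ereal (real (phi \<delta> N) / ln (real N)))" by (rule order_trans[rotated])
qed

end
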